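(* Let $R$ be an algebraic algebra over a field. Then the following are equivalent: $R$ is unit semi-nil clean; $R$ is periodic; the unit group ${\rm U}(R)$ is torsion.
   Context: Rings and algebras are associative with identity, not necessarily commutative. An algebra $R$ over a field $F$ is algebraic if every element of $R$ is a root of some non-zero polynomial over $F$. An element $x$ of a ring is periodic if there exist two different positive integers $m\neq n$ with $x^m=x^n$; a ring is periodic if all its elements are periodic. A ring is unit semi-nil clean if each of its units is the sum of a periodic element and a nilpotent element of the ring (no commutation required). A group is torsion if each of its elements has finite order. *)

theory Defs
  imports "HOL-Algebra.UnivPoly"
begin

(* The library locale "algebra" requires the algebra itself to be commutative. The following
   drops that; scalars must then be assumed to commute past both factors of a product. *)
locale assoc_algebra = module F R + ring R for F (structure) and R (structure) +
  assumes smult_mult_left: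
      "\<lbrakk>a \<in> carrier F; x \<in> carrier R; y \<in> carrier R\<rbrakk> \<Longrightarrow>
        (a \<odot>\<^bsub>R\<^esub> x) \<otimes>\<^bsub>R\<^esub> y = a \<odot>\<^bsub>R\<^esub> (x \<otimes>\<^bsub>R\<^esub> y)"
    and smult_mult_right:
      "\<lbrakk>a \<in> carrier F; x \<in> carrier R; y \<in> carrier R\<rbrakk> \<Longrightarrow>
        x \<otimes>\<^bsub>R\<^esub> (a \<odot>\<^bsub>R\<^esub> y) = a \<odot>\<^bsub>R\<^esub> (x \<otimes>\<^bsub>R\<^esub> y)"

(* "eval F R \<phi> x p" is the value of p at x, its coefficients c being read in R as \<phi> c,
   here the scalar multiple c \<odot> \<one> of the identity of R. *)
definition algebraic_element :: "('a, 'm) ring_scheme \<Rightarrow> ('a, 'b, 'n) module_scheme \<Rightarrow> 'b \<Rightarrow> bool"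
  where "algebraic_element F R x \<longleftrightarrow>
    (\<exists>p \<in> carrier (UP F). p \<noteq> \<zero>\<^bsub>UP F\<^esub> \<and>
      eval F R (\<lambda>c. c \<odot>\<^bsub>R\<^esub> \<one>\<^bsub>R\<^esub>) x p = \<zero>\<^bsub>R\<^esub>)"

definition algebraic_algebra :: "('a, 'm) ring_scheme \<Rightarrow> ('a, 'b, 'n) module_scheme \<Rightarrow> bool"
  where "algebraic_algebra F R \<longleftrightarrow>
    assoc_algebra F R \<and> (\<forall>x \<in> carrier R. algebraic_element F R x)"

definition periodic_element :: "('b, 'n) ring_scheme \<Rightarrow> 'b \<Rightarrow> bool"
  where "periodic_element R x \<longleftrightarrow>
    (\<exists>m n :: nat. 0 < m \<and> 0 < n \<and> m \<noteq> n \<and> x [^]\<^bsub>R\<^esub> m = x [^]\<^bsub>R\<^esub> n)"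

definition periodic_ring :: "('b, 'n) ring_scheme \<Rightarrow> bool"
  where "periodic_ring R \<longleftrightarrow> ring R \<and> (\<forall>x \<in> carrier R. periodic_element R x)"

definition nilpotent_element :: "('b, 'n) ring_scheme \<Rightarrow> 'b \<Rightarrow> bool"
  where "nilpotent_element R x \<longleftrightarrow> (\<exists>n :: nat. 0 < n \<and> x [^]\<^bsub>R\<^esub> n = \<zero>\<^bsub>R\<^esub>)"

definition unit_semi_nil_clean :: "('b, 'n) ring_scheme \<Rightarrow> bool"
  where "unit_semi_nil_clean R \<longleftrightarrow> ring R \<and>
    (\<forall>u \<in> Units R. \<exists>a \<in> carrier R. \<exists>b \<in> carrier R.
      periodic_element R a \<and> nilpotent_element R b \<and> u = a \<oplus>\<^bsub>R\<^esub> b)"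

definition torsion_group :: "('g, 'k) monoid_scheme \<Rightarrow> bool"
  where "torsion_group G \<longleftrightarrow> group G \<and>
    (\<forall>x \<in> carrier G. \<exists>n :: nat. 0 < n \<and> x [^]\<^bsub>G\<^esub> n = \<one>\<^bsub>G\<^esub>)"

end

theory Submission
  imports Defs "HOL-Algebra.Multiplicative_Group"
begin

text \<open>
  The scalars decide everything. If every non-zero scalar has finite order, then 2 being 0 or
  of finite order forces positive characteristic, so finitely many scalars lie in a finite
  subsemiring \<open>A\<close>, and an element \<open>x\<close> satisfying a monic equation over \<open>A\<close> has all its powers in a
  finite \<open>A\<close>-span; hence \<open>R\<close> is periodic. Torsion of the unit group makes the scalars
  torsion. If instead a non-zero scalar \<open>\<lambda>\<close> is the sum of a periodic \<open>a\<close> and a nilpotent \<open>b\<close>, the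
  last non-zero power \<open>w\<close> of \<open>b\<close> satisfies \<open>a w = \<lambda> w\<close>, so \<open>a\<^sup>m = a\<^sup>n\<close> gives \<open>\<lambda>\<^sup>m = \<lambda>\<^sup>n\<close>.
\<close>

text \<open>Horner evaluation uses only sums and products, so semirings are the natural domain for
  coefficients. The smallest one then consists of the natural multiples of the identity.\<close>

definition subsemiring :: "'a set \<Rightarrow> ('a, 'm) ring_scheme \<Rightarrow> bool"
  where "subsemiring A R \<longleftrightarrow> A \<subseteq> carrier R \<and> \<zero>\<^bsub>R\<^esub> \<in> A \<and> \<one>\<^bsub>R\<^esub> \<in> A \<and>
    (\<forall>a \<in> A. \<forall>b \<in> A. a \<oplus>\<^bsub>R\<^esub> b \<in> A \<and> a \<otimes>\<^bsub>R\<^esub> b \<in> A)"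

text \<open>The values at \<open>x\<close> of the polynomials of degree less than \<open>k\<close> over \<open>A\<close>, in Horner form.\<close>

primrec poly_values :: "('a, 'm) ring_scheme \<Rightarrow> 'a set \<Rightarrow> 'a \<Rightarrow> nat \<Rightarrow> 'a set"
  where
    "poly_values R A x 0 = {\<zero>\<^bsub>R\<^esub>}"
  | "poly_values R A x (Suc k) = (\<lambda>(a, v). a \<oplus>\<^bsub>R\<^esub> v \<otimes>\<^bsub>R\<^esub> x) ` (A \<times> poly_values R A x k)"

section \<open>Values of polynomials over coefficients that commute with \<open>x\<close>\<close>

context ring
begin

context
  fixes A x
  assumes A: "subsemiring A R" and x: "x \<in> carrier R"
    and comm: "\<And>a. a \<in> A \<Longrightarrow> a \<otimes> x = x \<otimes> a"
begin

lemma A_simps: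
  "a \<in> A \<Longrightarrow> a \<in> carrier R" "\<zero> \<in> A" "\<one> \<in> A"
  "a \<in> A \<Longrightarrow> b \<in> A \<Longrightarrow> a \<oplus> b \<in> A" "a \<in> A \<Longrightarrow> b \<in> A \<Longrightarrow> a \<otimes> b \<in> A"
  using A by (auto simp: subsemiring_def)

lemma finite_poly_values: "finite A \<Longrightarrow> finite (poly_values R A x k)"
  by (induction k) auto

lemma poly_values_SucI:
  "a \<in> A \<Longrightarrow> v \<in> poly_values R A x k \<Longrightarrow> a \<oplus> v \<otimes> x \<in> poly_values R A x (Suc k)"
  by auto

lemma poly_values_SucE:
  assumes "v \<in> poly_values R A x (Suc k)"
  obtains a w where "a \<in> A" "w \<in> poly_values R A x k" "v = a \<oplus> w \<otimes> x"
  using assms by auto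

lemma poly_values_closed: "v \<in> poly_values R A x k \<Longrightarrow> v \<in> carrier R"
  using x by (induction k arbitrary: v) (auto simp: A_simps)

lemma zero_in_poly_values: "\<zero> \<in> poly_values R A x k"
proof (induction k)
  case (Suc k)
  with poly_values_SucI[OF A_simps(2), of \<zero> k] show ?case using x by simp
qed simp

lemma subset_poly_values_Suc: "a \<in> A \<Longrightarrow> a \<in> poly_values R A x (Suc k)"
  using poly_values_SucI[OF _ zero_in_poly_values, of a k] x A_simps(1) by simp

lemma poly_values_mult_var: "v \<in> poly_values R A x k \<Longrightarrow> v \<otimes> x \<in> poly_values R A x (Suc k)"
  using poly_values_SucI[OF A_simps(2), of v k] x poly_values_closed by simp

lemma poly_values_add:
  "v \<in> poly_values R A x k \<Longrightarrow> w \<in> poly_values R A x k \<Longrightarrow> v \<oplus> w \<in> poly_values R A x k"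
proof (induction k arbitrary: v w)
  case (Suc k)
  obtain a v' where v: "a \<in> A" "v' \<in> poly_values R A x k" "v = a \<oplus> v' \<otimes> x"
    using Suc.prems(1) by (rule poly_values_SucE)
  obtain b w' where w: "b \<in> A" "w' \<in> poly_values R A x k" "w = b \<oplus> w' \<otimes> x"
    using Suc.prems(2) by (rule poly_values_SucE)
  have cl: "a \<in> carrier R" "b \<in> carrier R" "v' \<in> carrier R" "w' \<in> carrier R"
    using v w A_simps(1) poly_values_closed by auto
  have "v \<oplus> w = (a \<oplus> b) \<oplus> (v' \<oplus> w') \<otimes> x"
    using cl x v(3) w(3) by (simp add: l_distr a_ac)
  then show ?case
    using poly_values_SucI[OF A_simps(4)[OF v(1) w(1)] Suc.IH[OF v(2) w(2)]] by simp
qed simp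

lemma poly_values_mult_coeff:
  "a \<in> A \<Longrightarrow> v \<in> poly_values R A x k \<Longrightarrow> a \<otimes> v \<in> poly_values R A x k"
proof (induction k arbitrary: v)
  case (Suc k)
  obtain b w where v: "b \<in> A" "w \<in> poly_values R A x k" "v = b \<oplus> w \<otimes> x"
    using Suc.prems(2) by (rule poly_values_SucE)
  have cl: "a \<in> carrier R" "b \<in> carrier R" "w \<in> carrier R"
    using v Suc.prems A_simps(1) poly_values_closed by auto
  have "a \<otimes> v = a \<otimes> b \<oplus> (a \<otimes> w) \<otimes> x"
    using cl x v(3) by (simp add: r_distr m_assoc)
  then show ?case
    using poly_values_SucI[OF A_simps(5)[OF Suc.prems(1) v(1)] Suc.IH[OF Suc.prems(1) v(2)]] by simp
qed (simp add: A_simps)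

lemma poly_values_comm: "v \<in> poly_values R A x k \<Longrightarrow> v \<otimes> x = x \<otimes> v"
proof (induction k arbitrary: v)
  case (Suc k)
  obtain b w where v: "b \<in> A" "w \<in> poly_values R A x k" "v = b \<oplus> w \<otimes> x"
    using Suc.prems by (rule poly_values_SucE)
  have cl: "b \<in> carrier R" "w \<in> carrier R"
    using v A_simps(1) poly_values_closed by auto
  have "v \<otimes> x = x \<otimes> b \<oplus> (x \<otimes> w) \<otimes> x"
    using cl x v(3) comm[OF v(1)] Suc.IH[OF v(2)] by (simp add: l_distr)
  also have "\<dots> = x \<otimes> v"
    using cl x v(3) by (simp add: r_distr m_assoc)
  finally show ?case .
qed (use x in simp)

text \<open>Horner form gives direct access to the constant coefficient only. To attach a term at
  the top degree, it is pushed inwards through all Horner steps.\<close>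

lemma poly_values_add_monom:
  "v \<in> poly_values R A x k \<Longrightarrow> a \<in> A \<Longrightarrow> v \<oplus> a \<otimes> x [^] k \<in> poly_values R A x (Suc k)"
proof (induction k arbitrary: v)
  case 0
  then show ?case
    using subset_poly_values_Suc[of a 0] A_simps(1)[of a] by simp
next
  case (Suc k)
  obtain b w where v: "b \<in> A" "w \<in> poly_values R A x k" "v = b \<oplus> w \<otimes> x"
    using Suc.prems(1) by (rule poly_values_SucE)
  have "v \<oplus> a \<otimes> x [^] Suc k = b \<oplus> (w \<oplus> a \<otimes> x [^] k) \<otimes> x"
    using v x A_simps(1) Suc.prems(2) poly_values_closed[OF v(2)]
    by (simp add: l_distr a_assoc m_assoc)
  then show ?case
    using poly_values_SucI[OF v(1) Suc.IH[OF v(2) Suc.prems(2)]] by simp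
qed

text \<open>The inverse operation, splitting off the leading term. This is what allows a monic
  equation to lower the degree.\<close>

lemma poly_values_Suc_decomp:
  "v \<in> poly_values R A x (Suc k) \<Longrightarrow> \<exists>w \<in> poly_values R A x k. \<exists>a \<in> A. v = w \<oplus> a \<otimes> x [^] k"
proof (induction k arbitrary: v)
  case 0
  then show ?case using x A_simps(1) by auto
next
  case (Suc k)
  obtain b w where v: "b \<in> A" "w \<in> poly_values R A x (Suc k)" "v = b \<oplus> w \<otimes> x"
    using Suc.prems by (rule poly_values_SucE)
  obtain u a where u: "u \<in> poly_values R A x k" "a \<in> A" "w = u \<oplus> a \<otimes> x [^] k"
    using Suc.IH[OF v(2)] by blast
  have "v = (b \<oplus> u \<otimes> x) \<oplus> a \<otimes> x [^] Suc k"
    using v u x A_simps(1) poly_values_closed[OF u(1)]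
    by (simp add: l_distr a_assoc m_assoc)
  then show ?case
    using poly_values_SucI[OF v(1) u(1)] u(2) by blast
qed

lemma finsum_in_poly_values:
  assumes "\<And>i. i < k \<Longrightarrow> f i \<in> A"
  shows "(\<Oplus>i \<in> {..<k}. f i \<otimes> x [^] i) \<in> poly_values R A x k"
  using assms
proof (induction k)
  case (Suc k)
  have "(\<Oplus>i \<in> {..<Suc k}. f i \<otimes> x [^] i) = f k \<otimes> x [^] k \<oplus> (\<Oplus>i \<in> {..<k}. f i \<otimes> x [^] i)"
    using Suc.prems x A_simps(1) by (simp add: lessThan_Suc Pi_def)
  also have "\<dots> = (\<Oplus>i \<in> {..<k}. f i \<otimes> x [^] i) \<oplus> f k \<otimes> x [^] k"
    using Suc.prems x A_simps(1) by (intro a_comm) (auto intro!: finsum_closed)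
  finally show ?case
    using poly_values_add_monom[OF Suc.IH, of "f k"] Suc.prems by simp
qed simp

section \<open>Finite extensions generated by a root of a monic polynomial\<close>

context
  fixes d :: nat
  assumes monic: "x [^] d \<in> poly_values R A x d"
begin

text \<open>Multiplying by \<open>x\<close> creates at most one term of degree \<open>d\<close>;
  after splitting it off, the monic equation rewrites its \<open>x [^] d\<close> in lower
  powers.\<close>

lemma poly_values_stable: "v \<in> poly_values R A x d \<Longrightarrow> v \<otimes> x \<in> poly_values R A x d"
  using poly_values_Suc_decomp[OF poly_values_mult_var, of v d]
    poly_values_add poly_values_mult_coeff[OF _ monic] by auto

text \<open>Since \<open>w\<close> commutes with \<open>x\<close>, a Horner step on the left factor
  turns \<open>(u \<otimes> x) \<otimes> w\<close> into \<open>u \<otimes> (w \<otimes> x)\<close>,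
  and \<open>w \<otimes> x\<close> stays in the span by stability. The right factor changes in this
  way, so the induction must leave it arbitrary.\<close>

lemma poly_values_mult:
  "v \<in> poly_values R A x k \<Longrightarrow> w \<in> poly_values R A x d \<Longrightarrow> v \<otimes> w \<in> poly_values R A x d"
proof (induction k arbitrary: v w)
  case 0
  then show ?case using zero_in_poly_values poly_values_closed by simp
next
  case (Suc k)
  obtain b u where v: "b \<in> A" "u \<in> poly_values R A x k" "v = b \<oplus> u \<otimes> x"
    using Suc.prems(1) by (rule poly_values_SucE)
  have "v \<otimes> w = b \<otimes> w \<oplus> u \<otimes> (w \<otimes> x)"
    using v x A_simps(1) poly_values_closed[OF v(2)] poly_values_closed[OF Suc.prems(2)]
      poly_values_comm[OF Suc.prems(2)]
    by (simp add: l_distr m_assoc)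
  then show ?case
    using poly_values_add poly_values_mult_coeff[OF v(1) Suc.prems(2)]
      Suc.IH[OF v(2) poly_values_stable[OF Suc.prems(2)]] by simp
qed

text \<open>The span is A[x]. Together with \<open>finite_poly_values\<close> this adjoins one
  element to a finite subsemiring without losing finiteness.\<close>

lemma subsemiring_poly_values:
  assumes "0 < d"
  shows "subsemiring (poly_values R A x d) R" "A \<subseteq> poly_values R A x d" "x \<in> poly_values R A x d"
proof -
  show sub: "A \<subseteq> poly_values R A x d"
    using assms subset_poly_values_Suc by (cases d) auto
  then show "subsemiring (poly_values R A x d) R"
    using poly_values_closed zero_in_poly_values A_simps(3) poly_values_add poly_values_mult
    unfolding subsemiring_def by blast
  show "x \<in> poly_values R A x d"
    using poly_values_stable[of \<one>] sub A_simps(3) x by auto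
qed

lemma periodic_if_monic:
  assumes "finite A"
  shows "periodic_element R x"
proof -
  have pow: "x [^] (d + j) \<in> poly_values R A x d" for j
  proof (induction j)
    case (Suc j)
    then show ?case using poly_values_stable by simp
  qed (use monic in simp)
  \<comment> \<open>Pigeonhole on the powers in the finite span. The exponents start at
    \<open>d + 1\<close> so that they are positive even for \<open>d = 0\<close>.\<close>
  have "range (\<lambda>j. x [^] (d + Suc j)) \<subseteq> poly_values R A x d"
    using pow by blast
  then have "\<not> inj (\<lambda>j. x [^] (d + Suc j))"
    using finite_poly_values[OF assms] finite_subset finite_imageD infinite_UNIV_nat by blast
  then obtain i j where "i \<noteq> j" "x [^] (d + Suc i) = x [^] (d + Suc j)"
    unfolding inj_def by blast
  then show ?thesis
    unfolding periodic_element_def by (intro exI[of _ "d + Suc i"] exI[of _ "d + Suc j"]) simp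
qed

end

end

section \<open>Finite subsemirings from positive characteristic and torsion\<close>

text \<open>The natural multiples of the identity are the image of a semiring homomorphism from the
  natural numbers. Subtracting \<open>N\<close> from the multiplier does not change the value, so
  the multipliers below \<open>N\<close> already give everything.\<close>

lemma finite_prime_subsemiring:
  fixes N :: nat
  assumes N: "0 < N" "[N] \<cdot> \<one> = \<zero>"
  shows "\<exists>A. finite A \<and> subsemiring A R"
proof -
  let ?f = "\<lambda>k::nat. [k] \<cdot> \<one>"
  have add: "?f (k + l) = ?f k \<oplus> ?f l" for k l
    by (simp add: add.nat_pow_mult)
  have mult: "?f k \<otimes> ?f l = ?f (k * l)" for k l
    by (simp add: add_pow_ldistr add_pow_rdistr add.nat_pow_pow mult.commute)
  have "?f k \<in> ?f ` {..<N}" for k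
  proof (induction k rule: less_induct)
    case (less k)
    show ?case
    proof (cases "k < N")
      case False
      then have "?f k = ?f (k - N)"
        using add[of "k - N" N] N(2) by simp
      then show ?thesis using less.IH[of "k - N"] False N(1) by simp
    qed simp
  qed
  then have "range ?f \<subseteq> ?f ` {..<N}" by blast
  then have "finite (range ?f)" using finite_subset by blast
  moreover have "\<zero> \<in> range ?f" "\<one> \<in> range ?f"
    using rangeI[of ?f 0] rangeI[of ?f 1] by simp_all
  then have "subsemiring (range ?f) R"
    unfolding subsemiring_def by (auto simp: mult simp flip: add)
  ultimately show ?thesis by blast
qed

end

text \<open>The smaller power cancels. This serves both the units of the algebra and the non-zero
  scalars.\<close>

lemma (in monoid) unit_torsion_if_periodic:
  fixes m n :: nat
  assumes u: "u \<in> Units G" and "m \<noteq> n" "u [^] m = u [^] n"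
  shows "\<exists>k::nat>0. u [^] k = \<one>"
  using assms(2,3)
proof (induction m n rule: linorder_wlog)
  case (le i j)
  then have "u [^] i \<otimes> u [^] (j - i) = u [^] i \<otimes> \<one>"
    using u Units_closed by (subst nat_pow_mult) auto
  then have "u [^] (j - i) = \<one>"
    using u Units_pow_closed Units_closed Units_l_cancel by (metis nat_pow_closed one_closed)
  then show ?case using le by (intro exI[of _ "j - i"]) simp
qed metis

text \<open>The element 2 decides: if it is zero, \<open>N = 2\<close> works; otherwise its n-th
  power is 1 for some positive \<open>n\<close>, and \<open>N = 2 ^ n - 1\<close> works.\<close>

lemma (in field) char_pos_if_torsion:
  assumes "\<And>c. c \<in> carrier R \<Longrightarrow> c \<noteq> \<zero> \<Longrightarrow> \<exists>n::nat>0. c [^] n = \<one>"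
  shows "\<exists>N::nat>0. [N] \<cdot> \<one> = \<zero>"
proof (cases "[(2::nat)] \<cdot> \<one> = \<zero>")
  case False
  then obtain n :: nat where n: "n > 0" "([(2::nat)] \<cdot> \<one>) [^] n = \<one>"
    using assms[of "[(2::nat)] \<cdot> \<one>"] by auto
  have pow: "([(2::nat)] \<cdot> \<one>) [^] k = [(2 ^ k :: nat)] \<cdot> \<one>" for k :: nat
    by (induction k) (simp_all add: add_pow_ldistr add_pow_rdistr add.nat_pow_pow mult.commute)
  have "\<one> \<oplus> [(2 ^ n - 1 :: nat)] \<cdot> \<one> = [(2 ^ n :: nat)] \<cdot> \<one>"
    using add.nat_pow_mult[of \<one> 1 "2 ^ n - 1"] by simp
  also have "\<dots> = \<one>" using pow n(2) by simp
  finally have "[(2 ^ n - 1 :: nat)] \<cdot> \<one> = \<zero>"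
    by (metis add.nat_pow_closed add.r_cancel_one' one_closed add.l_cancel_one)
  moreover have "(2 ^ n - 1 :: nat) > 0" using n(1) one_less_power[of "2::nat" n] by simp
  ultimately show ?thesis by blast
qed (rule exI[of _ 2], simp)

text \<open>The elements are adjoined one by one, starting from the prime subsemiring. A non-zero
  element of finite order is a root of a monic polynomial over every subsemiring.\<close>

lemma (in field) finite_subset_in_finite_subsemiring:
  assumes tors: "\<And>c. c \<in> carrier R \<Longrightarrow> c \<noteq> \<zero> \<Longrightarrow> \<exists>n::nat>0. c [^] n = \<one>"
    and "finite C" "C \<subseteq> carrier R"
  shows "\<exists>A. finite A \<and> subsemiring A R \<and> C \<subseteq> A"
  using assms(2,3)
proof (induction C)
  case empty
  then show ?case
    using char_pos_if_torsion[OF tors] finite_prime_subsemiring by blast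
next
  case (insert c C)
  then obtain A where A: "finite A" "subsemiring A R" "C \<subseteq> A" by auto
  have c: "c \<in> carrier R" using insert by simp
  show ?case
  proof (cases "c = \<zero>")
    case True
    then show ?thesis using A by (auto simp: subsemiring_def)
  next
    case False
    then obtain n :: nat where n: "n > 0" "c [^] n = \<one>" using tors c by blast
    have comm: "a \<otimes> c = c \<otimes> a" if "a \<in> A" for a
      using that A(2) c by (auto simp: subsemiring_def intro: m_comm)
    obtain n' where "n = Suc n'" using n(1) by (cases n) auto
    \<comment> \<open>The monic equation is \<open>c [^] n = \<one>\<close>: its right-hand side is
      a constant from \<open>A\<close>, hence a value of degree below \<open>n\<close>, as
      \<open>n\<close> is positive.\<close>
    then have "c [^] n \<in> poly_values R A c n"
      using subset_poly_values_Suc[OF A(2) c comm, of \<one> n'] A(2) n(2)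
      by (simp add: subsemiring_def)
    from subsemiring_poly_values[OF A(2) c comm this n(1)] finite_poly_values[OF A(2) c comm A(1)]
    show ?thesis using A(3) by (intro exI[of _ "poly_values R A c n"]) auto
  qed
qed

section \<open>Scalars acting on the algebra, and reduction to a monic equation\<close>

locale algebra_over_field = K: field F + S: ring R + assoc_algebra F R
  for F :: "('a, 'm) ring_scheme" (structure) and R :: "('a, 'b, 'n) module_scheme" (structure)
begin

abbreviation scalar :: "'a \<Rightarrow> 'b"
  where "scalar c \<equiv> c \<odot>\<^bsub>R\<^esub> \<one>\<^bsub>R\<^esub>"

lemma scalar_mult: "c \<in> carrier F \<Longrightarrow> x \<in> carrier R \<Longrightarrow> scalar c \<otimes>\<^bsub>R\<^esub> x = c \<odot>\<^bsub>R\<^esub> x"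
  by (simp add: smult_mult_left)

lemma mult_scalar: "c \<in> carrier F \<Longrightarrow> x \<in> carrier R \<Longrightarrow> x \<otimes>\<^bsub>R\<^esub> scalar c = c \<odot>\<^bsub>R\<^esub> x"
  by (simp add: smult_mult_right)

lemma smult_cancel:
  assumes "c \<in> carrier F" "c \<noteq> \<zero>" "x \<in> carrier R" "c \<odot>\<^bsub>R\<^esub> x = \<zero>\<^bsub>R\<^esub>"
  shows "x = \<zero>\<^bsub>R\<^esub>"
proof -
  have c: "c \<in> Units F" using assms K.field_Units by simp
  then have "x = (inv c \<otimes> c) \<odot>\<^bsub>R\<^esub> x" using assms by simp
  also have "\<dots> = \<zero>\<^bsub>R\<^esub>" using assms c by (simp add: smult_assoc1 del: K.Units_l_inv)
  finally show ?thesis .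
qed

text \<open>A single non-zero vector distinguishes scalars. This transfers identities in the algebra
  back to the field.\<close>

lemma smult_right_cancel:
  assumes "c \<in> carrier F" "d \<in> carrier F" "x \<in> carrier R" "x \<noteq> \<zero>\<^bsub>R\<^esub>"
    and "c \<odot>\<^bsub>R\<^esub> x = d \<odot>\<^bsub>R\<^esub> x"
  shows "c = d"
proof -
  have "(c \<ominus> d) \<odot>\<^bsub>R\<^esub> x = \<zero>\<^bsub>R\<^esub>"
    using assms by (simp add: K.minus_eq smult_l_distr smult_l_minus S.r_neg)
  then show ?thesis
    using smult_cancel[of "c \<ominus> d" x] assms by auto
qed

lemma subsemiring_scalar_image:
  assumes "subsemiring A F"
  shows "subsemiring (scalar ` A) R"
proof -
  have A: "a \<in> carrier F" if "a \<in> A" for a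
    using that assms by (auto simp: subsemiring_def)
  have "scalar a \<oplus>\<^bsub>R\<^esub> scalar b = scalar (a \<oplus> b)" "scalar a \<otimes>\<^bsub>R\<^esub> scalar b = scalar (a \<otimes> b)"
    if "a \<in> A" "b \<in> A" for a b
    using that A by (simp_all add: smult_l_distr scalar_mult smult_assoc1)
  moreover have "scalar \<zero> = \<zero>\<^bsub>R\<^esub>" "scalar \<one> = \<one>\<^bsub>R\<^esub>"
    by simp_all
  ultimately show ?thesis
    using assms A unfolding subsemiring_def by (auto 0 4 intro: rev_image_eqI)
qed

text \<open>Division by the leading coefficient. A non-zero constant polynomial gives
  \<open>d = 0\<close>; the equation then reads 1 = 0 in the algebra, since the sum is
  empty.\<close>

lemma algebraic_element_monic:
  assumes x: "x \<in> carrier R" and "algebraic_element F R x"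
  obtains d :: nat and e where "\<And>i. e i \<in> carrier F"
    "x [^]\<^bsub>R\<^esub> d = (\<Oplus>\<^bsub>R\<^esub>i \<in> {..<d}. scalar (e i) \<otimes>\<^bsub>R\<^esub> x [^]\<^bsub>R\<^esub> i)"
proof -
  interpret P: UP_ring F "UP F" by unfold_locales
  obtain p where p: "p \<in> carrier (UP F)" "p \<noteq> \<zero>\<^bsub>UP F\<^esub>"
    and root: "eval F R scalar x p = \<zero>\<^bsub>R\<^esub>"
    using assms(2) unfolding algebraic_element_def by blast
  define d where "d = deg F p"
  define c where "c = coeff (UP F) p"
  have c: "c i \<in> carrier F" for i
    using p(1) unfolding c_def by (rule P.coeff_closed)
  have "c d \<noteq> \<zero>"
    using P.lcoeff_nonzero[OF p(2,1)] unfolding c_def d_def .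
  then have unit: "c d \<in> Units F" using c K.field_Units by simp
  define s where "s = (\<Oplus>\<^bsub>R\<^esub>i \<in> {..<d}. scalar (c i) \<otimes>\<^bsub>R\<^esub> x [^]\<^bsub>R\<^esub> i)"
  have s: "s \<in> carrier R"
    unfolding s_def using c x by (auto intro!: S.finsum_closed)
  \<comment> \<open>The sign moves the lower terms \<open>s\<close> to the other side of the
    equation, and the inverse makes the leading coefficient 1.\<close>
  define a where "a = \<ominus> (inv (c d))"
  have a: "a \<in> carrier F" unfolding a_def using unit by simp
  have "\<zero>\<^bsub>R\<^esub> = (\<Oplus>\<^bsub>R\<^esub>i \<in> {..d}. scalar (c i) \<otimes>\<^bsub>R\<^esub> x [^]\<^bsub>R\<^esub> i)"
    using root p(1) by (simp add: eval_def c_def d_def)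
  also have "{..d} = insert d {..<d}" by auto
  also have "(\<Oplus>\<^bsub>R\<^esub>i \<in> insert d {..<d}. scalar (c i) \<otimes>\<^bsub>R\<^esub> x [^]\<^bsub>R\<^esub> i) = c d \<odot>\<^bsub>R\<^esub> x [^]\<^bsub>R\<^esub> d \<oplus>\<^bsub>R\<^esub> s"
    unfolding s_def using c x by (subst S.finsum_insert) (auto simp: scalar_mult)
  finally have "s = \<ominus>\<^bsub>R\<^esub> (c d \<odot>\<^bsub>R\<^esub> x [^]\<^bsub>R\<^esub> d)"
    using s c x by (intro S.minus_equality[symmetric]) (simp_all add: S.a_comm)
  then have "a \<odot>\<^bsub>R\<^esub> s = (inv (c d) \<otimes> c d) \<odot>\<^bsub>R\<^esub> x [^]\<^bsub>R\<^esub> d"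
    using unit c x by (simp add: a_def smult_l_minus smult_r_minus smult_assoc1 del: K.Units_l_inv)
  also have "\<dots> = x [^]\<^bsub>R\<^esub> d"
    using unit x by simp
  finally have "x [^]\<^bsub>R\<^esub> d = a \<odot>\<^bsub>R\<^esub> s" ..
  also have "\<dots> = (\<Oplus>\<^bsub>R\<^esub>i \<in> {..<d}. a \<odot>\<^bsub>R\<^esub> (scalar (c i) \<otimes>\<^bsub>R\<^esub> x [^]\<^bsub>R\<^esub> i))"
    unfolding s_def using a c x by (intro finsum_smult_ldistr) auto
  also have "\<dots> = (\<Oplus>\<^bsub>R\<^esub>i \<in> {..<d}. scalar (a \<otimes> c i) \<otimes>\<^bsub>R\<^esub> x [^]\<^bsub>R\<^esub> i)"
    using a c x by (intro S.finsum_cong') (auto simp: smult_mult_left smult_assoc1)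
  finally show ?thesis
    using that[of "\<lambda>i. a \<otimes> c i" d] a c by simp
qed

lemma periodic_if_scalars_torsion:
  assumes tors: "\<And>c. c \<in> carrier F \<Longrightarrow> c \<noteq> \<zero> \<Longrightarrow> \<exists>n::nat>0. c [^] n = \<one>"
    and x: "x \<in> carrier R" and alg: "algebraic_element F R x"
  shows "periodic_element R x"
proof -
  obtain d :: nat and e where e: "\<And>i. e i \<in> carrier F"
    and monic: "x [^]\<^bsub>R\<^esub> d = (\<Oplus>\<^bsub>R\<^esub>i \<in> {..<d}. scalar (e i) \<otimes>\<^bsub>R\<^esub> x [^]\<^bsub>R\<^esub> i)"
    using algebraic_element_monic[OF x alg] by blast
  \<comment> \<open>Only the coefficients with index below \<open>d\<close> occur, so finitely many
    scalars have to be captured.\<close>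
  obtain A where A: "finite A" "subsemiring A F" "e ` {..<d} \<subseteq> A"
    using K.finite_subset_in_finite_subsemiring[OF tors, of "e ` {..<d}"] e by auto
  have B: "subsemiring (scalar ` A) R"
    using A(2) by (rule subsemiring_scalar_image)
  have comm: "b \<otimes>\<^bsub>R\<^esub> x = x \<otimes>\<^bsub>R\<^esub> b" if "b \<in> scalar ` A" for b
    using that A(2) x by (auto simp: subsemiring_def scalar_mult mult_scalar subset_iff)
  have "x [^]\<^bsub>R\<^esub> d \<in> poly_values R (scalar ` A) x d"
    unfolding monic using A(3) by (intro S.finsum_in_poly_values[OF B x comm]) auto
  from S.periodic_if_monic[OF B x comm this] A(1) show ?thesis by simp
qed

section \<open>Torsion of the scalars from conditions on the units\<close>

lemma scalar_pow: "c \<in> carrier F \<Longrightarrow> scalar c [^]\<^bsub>R\<^esub> (n::nat) = scalar (c [^] n)"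
  by (induction n) (simp_all add: mult_scalar smult_assoc1 K.m_comm)

lemma scalar_unit:
  assumes "c \<in> carrier F" "c \<noteq> \<zero>"
  shows "scalar c \<in> Units R"
proof -
  have c: "c \<in> Units F" using assms K.field_Units by simp
  have "scalar (inv c) \<otimes>\<^bsub>R\<^esub> scalar c = \<one>\<^bsub>R\<^esub>" "scalar c \<otimes>\<^bsub>R\<^esub> scalar (inv c) = \<one>\<^bsub>R\<^esub>"
    using assms c by (simp_all add: scalar_mult flip: smult_assoc1)
  then show ?thesis
    unfolding Units_def using assms c by auto
qed

lemma scalar_torsion_if_unit_torsion:
  assumes "\<one>\<^bsub>R\<^esub> \<noteq> \<zero>\<^bsub>R\<^esub>" "torsion_group (units_of R)" and c: "c \<in> carrier F" "c \<noteq> \<zero>"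
  shows "\<exists>n::nat>0. c [^] n = \<one>"
proof -
  obtain n :: nat where n: "0 < n" "scalar c [^]\<^bsub>R\<^esub> n = \<one>\<^bsub>R\<^esub>"
    using assms(2) scalar_unit[OF c]
    by (auto simp: torsion_group_def units_of_carrier units_of_one S.units_of_pow)
  then have "scalar (c [^] n) = scalar \<one>"
    using c by (simp add: scalar_pow)
  then show ?thesis
    using n(1) smult_right_cancel[of "c [^] n" \<one> "\<one>\<^bsub>R\<^esub>"] assms(1) c by auto
qed

lemma scalar_torsion_if_clean:
  assumes nontriv: "\<one>\<^bsub>R\<^esub> \<noteq> \<zero>\<^bsub>R\<^esub>" and "unit_semi_nil_clean R"
    and c: "c \<in> carrier F" "c \<noteq> \<zero>"
  shows "\<exists>n::nat>0. c [^] n = \<one>"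
proof -
  obtain a b where ab: "a \<in> carrier R" "b \<in> carrier R" "scalar c = a \<oplus>\<^bsub>R\<^esub> b"
    and "periodic_element R a" "nilpotent_element R b"
    using assms(2) scalar_unit[OF c] unfolding unit_semi_nil_clean_def by blast
  then obtain m n k :: nat where mn: "m \<noteq> n" "a [^]\<^bsub>R\<^esub> m = a [^]\<^bsub>R\<^esub> n"
    and k: "b [^]\<^bsub>R\<^esub> k = \<zero>\<^bsub>R\<^esub>"
    unfolding periodic_element_def nilpotent_element_def by blast
  \<comment> \<open>\<open>l\<close> is one less than the nilpotency index of \<open>b\<close>. It
    exists because \<open>b\<close> to the power 0 is the identity, which is non-zero by
    \<open>nontriv\<close>.\<close>
  obtain l where l: "b [^]\<^bsub>R\<^esub> Suc l = \<zero>\<^bsub>R\<^esub>" "b [^]\<^bsub>R\<^esub> l \<noteq> \<zero>\<^bsub>R\<^esub>"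
    using ex_least_nat_less[of "\<lambda>i. b [^]\<^bsub>R\<^esub> i = \<zero>\<^bsub>R\<^esub>" k] k nontriv by fastforce
  define w where "w = b [^]\<^bsub>R\<^esub> l"
  have w: "w \<in> carrier R" "w \<noteq> \<zero>\<^bsub>R\<^esub>"
    using ab l by (simp_all add: w_def)
  have bw: "b \<otimes>\<^bsub>R\<^esub> w = \<zero>\<^bsub>R\<^esub>"
    using ab l(1) unfolding w_def by (metis S.nat_pow_Suc2)
  \<comment> \<open>Multiplying \<open>scalar c = a + b\<close> by \<open>w\<close> on the right
    removes \<open>b\<close>. Thus \<open>w\<close> is an eigenvector of left multiplication by
    \<open>a\<close>, with eigenvalue \<open>c\<close>.\<close>
  have aw: "a \<otimes>\<^bsub>R\<^esub> w = c \<odot>\<^bsub>R\<^esub> w"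
    using ab bw w S.l_distr[of a b w] scalar_mult[of c w] c by simp
  have pow: "a [^]\<^bsub>R\<^esub> i \<otimes>\<^bsub>R\<^esub> w = c [^] i \<odot>\<^bsub>R\<^esub> w" for i :: nat
  proof (induction i)
    case (Suc i)
    have "a [^]\<^bsub>R\<^esub> Suc i \<otimes>\<^bsub>R\<^esub> w = a [^]\<^bsub>R\<^esub> i \<otimes>\<^bsub>R\<^esub> (c \<odot>\<^bsub>R\<^esub> w)"
      using ab w aw by (simp add: S.m_assoc)
    then show ?case
      using ab w c Suc by (simp add: smult_mult_right smult_assoc1 K.m_comm)
  qed (use w in simp)
  \<comment> \<open>Equal powers of \<open>a\<close> act equally on \<open>w\<close>, and since
    \<open>w\<close> is non-zero their eigenvalues agree.\<close>
  have cmn: "c [^] m = c [^] n"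
    using pow[of m] pow[of n] mn(2) smult_right_cancel[of "c [^] m" "c [^] n" w] w c by simp
  have "c \<in> Units F" using c K.field_Units by simp
  then show ?thesis
    using K.unit_torsion_if_periodic mn(1) cmn by blast
qed

end

section \<open>Consequences of periodicity, the trivial ring, and the equivalence\<close>

lemma (in ring) torsion_if_periodic:
  assumes "periodic_ring R"
  shows "torsion_group (units_of R)"
proof -
  have "\<exists>n::nat>0. u [^] n = \<one>" if "u \<in> Units R" for u
    using assms that Units_closed unit_torsion_if_periodic
    unfolding periodic_ring_def periodic_element_def by blast
  then show ?thesis
    by (auto simp: torsion_group_def units_group units_of_carrier units_of_one units_of_pow)
qed

lemma (in ring) clean_if_periodic:
  assumes "periodic_ring R"
  shows "unit_semi_nil_clean R"
proof -
  have "nilpotent_element R \<zero>"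
    unfolding nilpotent_element_def by (intro exI[of _ 1]) simp
  then show ?thesis
    using assms ring_axioms unfolding unit_semi_nil_clean_def periodic_ring_def
    by (metis Units_closed r_zero zero_closed)
qed

text \<open>The trivial ring is treated separately: all scalars collapse to zero there, so nothing
  about the field can be read off from the algebra.\<close>

lemma (in ring) periodic_if_trivial:
  assumes "\<one> = \<zero>"
  shows "periodic_ring R"
proof -
  have "x [^] (1::nat) = x [^] (2::nat)" if "x \<in> carrier R" for x
    using that one_zeroD[OF assms] nat_pow_zero[of 2] by auto
  moreover have "(0::nat) < 1" "(0::nat) < 2" "(1::nat) \<noteq> 2" by simp_all
  ultimately show ?thesis
    using ring_axioms unfolding periodic_ring_def periodic_element_def by blast
qed

theorem theorem4p6:
  fixes F :: "('a, 'm) ring_scheme" and R :: "('a, 'b, 'n) module_scheme"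
  assumes "field F"
    and "algebraic_algebra F R"
  shows "(unit_semi_nil_clean R \<longleftrightarrow> periodic_ring R) \<and>
    (periodic_ring R \<longleftrightarrow> torsion_group (units_of R))"
proof -
  have "assoc_algebra F R" and alg: "\<And>x. x \<in> carrier R \<Longrightarrow> algebraic_element F R x"
    using assms(2) by (auto simp: algebraic_algebra_def)
  then interpret algebra_over_field F R
    by (intro algebra_over_field.intro assms(1)) (auto simp: assoc_algebra_def)
  \<comment> \<open>Both conditions lead to periodicity along the same route, torsion of the
    non-zero scalars, so they are handled as one disjunction.\<close>
  have "periodic_ring R" if "unit_semi_nil_clean R \<or> torsion_group (units_of R)"
  proof (cases "\<one>\<^bsub>R\<^esub> = \<zero>\<^bsub>R\<^esub>")
    case False
    then show ?thesis
      using that scalar_torsion_if_clean scalar_torsion_if_unit_torsion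
        periodic_if_scalars_torsion alg S.ring_axioms
      unfolding periodic_ring_def by metis
  qed (rule S.periodic_if_trivial)
  then show ?thesis
    using S.clean_if_periodic S.torsion_if_periodic by blast
qed

end
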